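(* Let $x=[0;a_1,a_2,\dots,a_n,a_{n+1},\dots]$ be a real number given by its regular continued fraction expansion, let $n\ge 1$ be an index such that the partial quotient $a_{n+1}$ exists, and put $m=\min\{a_n,a_{n+1}\}\ge 1$ and $M=\max\{a_n,a_{n+1}\}$. Assume $M\ge 2$. (i) If $m=M\ge 2$, then $$\min\{\Theta_{n-1}(x),\Theta_n(x)\}\le \frac{m}{m^2+1}\le\frac25 \qquad\text{and}\qquad \max\{\Theta_{n-1}(x),\Theta_n(x)\}\ge \frac{m+1}{(m+1)^2+1}.$$ (ii) If $1\le m<M$, then $$\min\{\Theta_{n-1}(x),\Theta_n(x)\}\le \frac{m+1}{(m+1)M+1}\le\frac25 \qquad\text{and}\qquad \max\{\Theta_{n-1}(x),\Theta_n(x)\}\ge \frac{M}{(m+1)M+1}.$$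
   Context: The regular continued fraction (RCF) expansion of $x\in[0,1)$ is $x=[0;a_1,a_2,\dots]=\cfrac{1}{a_1+\cfrac{1}{a_2+\cdots}}$ with partial quotients $a_i$ positive integers; it is infinite (and unique) if $x$ is irrational and finite if $x$ is rational. The RCF convergents are $p_k/q_k=[0;a_1,\dots,a_k]$ in lowest terms with $q_k>0$; here $p_0/q_0=0/1$, and $q_k=a_kq_{k-1}+q_{k-2}$ with $q_{-1}=0$, $q_0=1$. The approximation coefficients of $x$ are $$\Theta_k(x)=q_k^2\left|x-\frac{p_k}{q_k}\right|.$$ *)

theory Defs
  imports Complex_Main "HOL-Library.Extended_Nat"
begin

text \<open>The finite continued fraction \<open>[0; a\<^sub>1, \<dots>, a\<^sub>k]\<close>.\<close>

fun cfrac :: "nat list \<Rightarrow> rat" where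
  "cfrac [] = 0"
| "cfrac (a # as) = 1 / (of_nat a + cfrac as)"

text \<open>
  Partial quotients are given by a function \<open>a :: nat \<Rightarrow> nat\<close>, of which only the values
  \<open>a 1, a 2, \<dots>\<close> matter (and, for a finite expansion of length \<open>N\<close>, only \<open>a 1, \<dots>, a N\<close>).
\<close>

definition convergent_rcf :: "(nat \<Rightarrow> nat) \<Rightarrow> nat \<Rightarrow> rat" where
  "convergent_rcf a k = cfrac (map a [1..<Suc k])"

text \<open>\<open>quotient_of\<close> yields numerator and denominator in lowest terms, with positive denominator.\<close>

definition rcf_p :: "(nat \<Rightarrow> nat) \<Rightarrow> nat \<Rightarrow> int" where
  "rcf_p a k = fst (quotient_of (convergent_rcf a k))"

definition rcf_q :: "(nat \<Rightarrow> nat) \<Rightarrow> nat \<Rightarrow> int" where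
  "rcf_q a k = snd (quotient_of (convergent_rcf a k))"

text \<open>
  \<open>is_rcf x a N\<close>: the number \<open>x \<in> [0,1)\<close> has the regular continued fraction expansion
  \<open>[0; a 1, a 2, \<dots>]\<close> with \<open>N \<le> \<infinity>\<close> partial quotients. An infinite expansion denotes the
  limit of its convergents. The last partial quotient of a finite expansion may be 1, so both
  finite expansions of a rational number are admitted.
\<close>

definition is_rcf :: "real \<Rightarrow> (nat \<Rightarrow> nat) \<Rightarrow> enat \<Rightarrow> bool" where
  "is_rcf x a N \<longleftrightarrow>
     0 \<le> x \<and> x < 1 \<and>
     (\<forall>i\<ge>1. enat i \<le> N \<longrightarrow> a i \<ge> 1) \<and>
     (case N of
        enat k \<Rightarrow> x = of_rat (convergent_rcf a k)
      | \<infinity> \<Rightarrow> (\<lambda>k. of_rat (convergent_rcf a k)) \<longlonglongrightarrow> x)"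

definition approx_coeff :: "(nat \<Rightarrow> nat) \<Rightarrow> real \<Rightarrow> nat \<Rightarrow> real" where
  "approx_coeff a x k =
     (of_int (rcf_q a k))\<^sup>2 * \<bar>x - of_int (rcf_p a k) / of_int (rcf_q a k)\<bar>"

text \<open>The recurrences for \<open>p\<^sub>k\<close> and \<open>q\<^sub>k\<close>, as a check on the definitions above.\<close>

fun cfrac_pair :: "nat list \<Rightarrow> int \<times> int" where
  "cfrac_pair [] = (0, 1)"
| "cfrac_pair (a # as) =
     (snd (cfrac_pair as), int a * snd (cfrac_pair as) + fst (cfrac_pair as))"

lemma cfrac_pair_props:
  assumes "\<forall>a\<in>set as. a \<ge> 1"
  shows "fst (cfrac_pair as) \<ge> 0 \<and> snd (cfrac_pair as) > 0 \<and>
         coprime (fst (cfrac_pair as)) (snd (cfrac_pair as)) \<and>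
         cfrac as = of_int (fst (cfrac_pair as)) / of_int (snd (cfrac_pair as))"
  using assms
proof (induction as)
  case Nil
  show ?case by simp
next
  case (Cons a as)
  define p where "p = fst (cfrac_pair as)"
  define q where "q = snd (cfrac_pair as)"
  have IH: "p \<ge> 0" "q > 0" "coprime p q" "cfrac as = of_int p / of_int q"
    using Cons by (auto simp: p_def q_def)
  have a: "int a \<ge> 1" using Cons.prems by simp
  have pos: "int a * q + p > 0"
    using IH a by (simp add: add_pos_nonneg)
  have cop: "coprime q (int a * q + p)"
    using IH(3) by (metis add.commute coprime_commute coprime_iff_gcd_eq_1 gcd_add_mult mult.commute)
  have "cfrac (a # as) = of_int q / of_int (int a * q + p)"
    using IH(2) by (simp add: IH(4) field_simps)
  then show ?case
    using IH pos cop by (simp flip: p_def q_def)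
qed

lemma quotient_of_cfrac:
  assumes "\<forall>a\<in>set as. a \<ge> 1"
  shows "quotient_of (cfrac as) = cfrac_pair as"
  using cfrac_pair_props[OF assms]
  by (metis Fract_of_int_quotient prod.collapse quotient_of_Fract normalize_stable)

lemma cfrac_pair_append:
  "fst (cfrac_pair (as @ [b, c])) = int c * fst (cfrac_pair (as @ [b])) + fst (cfrac_pair as)"
  "snd (cfrac_pair (as @ [b, c])) = int c * snd (cfrac_pair (as @ [b])) + snd (cfrac_pair as)"
  by (induction as) (auto simp: algebra_simps)

lemma rcf_p_q_init:
  "rcf_p a 0 = 0" "rcf_q a 0 = 1"
  "a 1 \<ge> 1 \<Longrightarrow> rcf_p a 1 = 1" "a 1 \<ge> 1 \<Longrightarrow> rcf_q a 1 = int (a 1)"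
  using quotient_of_cfrac[of "[a 1]"]
  by (simp_all add: rcf_p_def rcf_q_def convergent_rcf_def)

lemma rcf_p_q_rec:
  assumes "\<forall>i\<in>{1..Suc (Suc k)}. a i \<ge> 1"
  shows "rcf_p a (Suc (Suc k)) = int (a (Suc (Suc k))) * rcf_p a (Suc k) + rcf_p a k"
    and "rcf_q a (Suc (Suc k)) = int (a (Suc (Suc k))) * rcf_q a (Suc k) + rcf_q a k"
proof -
  have eq: "quotient_of (convergent_rcf a j) = cfrac_pair (map a [1..<Suc j])"
    if "j \<le> Suc (Suc k)" for j
    unfolding convergent_rcf_def using assms that by (intro quotient_of_cfrac) auto
  show "rcf_p a (Suc (Suc k)) = int (a (Suc (Suc k))) * rcf_p a (Suc k) + rcf_p a k"
    and "rcf_q a (Suc (Suc k)) = int (a (Suc (Suc k))) * rcf_q a (Suc k) + rcf_q a k"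
    using cfrac_pair_append[of "map a [1..<Suc k]" "a (Suc k)" "a (Suc (Suc k))"]
    by (simp_all add: rcf_p_def rcf_q_def eq)
qed

end

theory Submission
  imports Defs
begin

text \<open>
  Let \<open>t = [0; a\<^bsub>n+1\<^esub>, a\<^bsub>n+2\<^esub>, \<dots>]\<close> be the future of \<open>x\<close> at time \<open>n\<close>. Since
  \<open>x = (p\<^sub>n + t p\<^bsub>n-1\<^esub>) / (q\<^sub>n + t q\<^bsub>n-1\<^esub>)\<close> and \<open>p\<^sub>n q\<^bsub>n-1\<^esub> - p\<^bsub>n-1\<^esub> q\<^sub>n = \<plusminus>1\<close>, putting
  \<open>u = 1 / t\<close> and \<open>w = q\<^sub>n / q\<^bsub>n-1\<^esub>\<close> gives
  \<open>\<Theta>\<^bsub>n-1\<^esub> = 1 / (w + 1 / u)\<close> and \<open>\<Theta>\<^sub>n = 1 / (u + 1 / w)\<close>, where \<open>a\<^sub>n \<le> w \<le> a\<^sub>n + 1\<close> and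
  \<open>a\<^bsub>n+1\<^esub> \<le> u \<le> a\<^bsub>n+1\<^esub> + 1\<close>. The bounds are then monotonicity statements about
  \<open>1 / (w + 1 / u)\<close> on this rectangle.
\<close>

section \<open>Finite continued fractions: bounds and splitting\<close>

lemma cfrac_bounds:
  assumes "\<forall>a\<in>set as. a \<ge> 1"
  shows "0 \<le> cfrac as" "cfrac as \<le> 1"
proof -
  have "0 \<le> cfrac as \<and> cfrac as \<le> 1"
    using assms
  proof (induction as)
    case (Cons b as)
    then have "of_nat b \<ge> (1::rat)" "0 \<le> cfrac as" by simp_all
    then show ?case by simp
  qed simp
  then show "0 \<le> cfrac as" "cfrac as \<le> 1" by simp_all
qed

lemma cfrac_Cons_bounds:
  assumes "\<forall>c\<in>set (b # as). c \<ge> 1"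
  shows "1 / (of_nat b + 1) \<le> cfrac (b # as)" "cfrac (b # as) \<le> 1 / of_nat b"
proof -
  have "0 \<le> cfrac as" "cfrac as \<le> 1" "of_nat b \<ge> (1::rat)"
    using cfrac_bounds[of as] assms by simp_all
  then show "1 / (of_nat b + 1) \<le> cfrac (b # as)" "cfrac (b # as) \<le> 1 / of_nat b"
    by (auto intro!: divide_left_mono mult_pos_pos)
qed

text \<open>Prepending \<open>c\<close> sends a numerator-denominator pair \<open>(p, q)\<close> to
  \<open>(q, c * q + p)\<close>. This map is linear, so it preserves the combination with weight
  \<open>cfrac bs\<close>, and induction on the prefix applies.\<close>

lemma cfrac_append:
  assumes "\<forall>c\<in>set (as @ b # bs). c \<ge> 1"
  shows "cfrac (as @ b # bs) =
    (of_int (fst (cfrac_pair (as @ [b]))) + cfrac bs * of_int (fst (cfrac_pair as))) /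
    (of_int (snd (cfrac_pair (as @ [b]))) + cfrac bs * of_int (snd (cfrac_pair as)))"
  using assms
proof (induction as)
  case Nil
  then show ?case by simp
next
  case (Cons c as)
  let ?D = "of_int (snd (cfrac_pair (as @ [b]))) + cfrac bs * of_int (snd (cfrac_pair as))"
  have "snd (cfrac_pair (as @ [b])) > 0" "snd (cfrac_pair as) > 0" "cfrac bs \<ge> 0"
    using Cons.prems cfrac_pair_props[of "as @ [b]"] cfrac_pair_props[of as] cfrac_bounds[of bs]
    by auto
  then have "?D > 0" by (intro add_pos_nonneg) simp_all
  then have "1 / (of_nat c + y / ?D) = ?D / (of_nat c * ?D + y)" for y
    by (simp add: field_simps)
  with Cons show ?case by (simp add: algebra_simps)
qed

section \<open>Convergents, their denominators and their determinant\<close>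

lemma rcf_pair_eq:
  assumes "\<forall>i\<in>{1..k}. a i \<ge> 1"
  shows "rcf_p a k = fst (cfrac_pair (map a [1..<Suc k]))"
    "rcf_q a k = snd (cfrac_pair (map a [1..<Suc k]))"
  using quotient_of_cfrac[of "map a [1..<Suc k]"] assms
  by (auto simp: rcf_p_def rcf_q_def convergent_rcf_def)

lemma convergent_rcf_tail:
  assumes "\<forall>i\<in>{1..k}. a i \<ge> 1" and "Suc j \<le> k"
  defines "t \<equiv> cfrac (map a [Suc (Suc j)..<Suc k])"
  shows "convergent_rcf a k =
    (of_int (rcf_p a (Suc j)) + t * of_int (rcf_p a j)) /
    (of_int (rcf_q a (Suc j)) + t * of_int (rcf_q a j))"
proof -
  have upt: "[1..<Suc k] = [1..<Suc j] @ Suc j # [Suc (Suc j)..<Suc k]"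
    using assms(2) upt_add_eq_append[of 1 "Suc j" "k - j"] by (simp add: upt_conv_Cons)
  have "\<forall>c\<in>set (map a [1..<Suc j] @ a (Suc j) # map a [Suc (Suc j)..<Suc k]). c \<ge> 1"
    using assms(1,2) by auto
  from cfrac_append[OF this] show ?thesis
    using assms(1,2) unfolding convergent_rcf_def upt t_def
    by (simp add: rcf_pair_eq del: upt_Suc) (simp add: upt_Suc)
qed

text \<open>These bounds place \<open>w\<close> in its interval. In the recurrence the added term is
  the preceding denominator, which is nonnegative and at most the current one; the lower bound at
  the previous index supplies this monotonicity.\<close>

lemma rcf_q_bounds:
  assumes "\<forall>i\<in>{1..Suc j}. a i \<ge> 1"
  shows "rcf_q a j > 0"
    "int (a (Suc j)) * rcf_q a j \<le> rcf_q a (Suc j)"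
    "rcf_q a (Suc j) \<le> (int (a (Suc j)) + 1) * rcf_q a j"
proof -
  have "rcf_q a j > 0 \<and> int (a (Suc j)) * rcf_q a j \<le> rcf_q a (Suc j) \<and>
    rcf_q a (Suc j) \<le> (int (a (Suc j)) + 1) * rcf_q a j"
    using assms
  proof (induction j)
    case 0
    then show ?case using rcf_p_q_init[of a] by simp
  next
    case (Suc j)
    then have IH: "rcf_q a j > 0" "int (a (Suc j)) * rcf_q a j \<le> rcf_q a (Suc j)"
      and "int (a (Suc j)) \<ge> 1" by auto
    then have "rcf_q a j \<le> rcf_q a (Suc j)"
      using mult_right_mono[of 1 "int (a (Suc j))" "rcf_q a j"] by linarith
    with IH rcf_p_q_rec(2)[OF Suc.prems] show ?case by (simp add: algebra_simps)
  qed
  then show "rcf_q a j > 0" "int (a (Suc j)) * rcf_q a j \<le> rcf_q a (Suc j)"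
    "rcf_q a (Suc j) \<le> (int (a (Suc j)) + 1) * rcf_q a j" by blast+
qed

text \<open>Substituting the recurrence cancels the terms with the new partial quotient and leaves
  the previous determinant with opposite sign.\<close>

lemma rcf_det:
  assumes "\<forall>i\<in>{1..Suc j}. a i \<ge> 1"
  shows "\<bar>rcf_p a (Suc j) * rcf_q a j - rcf_p a j * rcf_q a (Suc j)\<bar> = 1"
  using assms
proof (induction j)
  case 0
  then show ?case using rcf_p_q_init[of a] by simp
next
  case (Suc j)
  then have "\<bar>rcf_p a (Suc j) * rcf_q a j - rcf_p a j * rcf_q a (Suc j)\<bar> = 1" by simp
  then show ?case
    unfolding rcf_p_q_rec[OF Suc.prems] by (simp add: algebra_simps abs_minus_commute)
qed

section \<open>The future of an expansion and its approximation coefficients\<close>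

lemma is_rcf_quotient_pos:
  assumes "is_rcf x a N" and "enat k \<le> N" and "1 \<le> i" and "i \<le> k"
  shows "a i \<ge> 1"
proof -
  have "enat i \<le> N" using assms(2,4) by (meson enat_ord_simps(1) order_trans)
  with assms(1,3) show ?thesis by (simp add: is_rcf_def)
qed

text \<open>Compactness replaces a separate convergence proof for the tail: the later convergents
  lie in the image of a compact interval under a continuous map, so their limit does too.\<close>

lemma is_rcf_tail:
  assumes "is_rcf x a N" and "enat (Suc (Suc j)) \<le> N"
  obtains t :: real where "1 / (real (a (Suc (Suc j))) + 1) \<le> t" "t \<le> 1 / real (a (Suc (Suc j)))"
    "x = (of_int (rcf_p a (Suc j)) + t * of_int (rcf_p a j)) /
      (of_int (rcf_q a (Suc j)) + t * of_int (rcf_q a j))"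
proof -
  define b where "b = a (Suc (Suc j))"
  define I where "I = {1 / (real b + 1) .. 1 / real b}"
  define f where "f t = (of_int (rcf_p a (Suc j)) + t * of_int (rcf_p a j)) /
      (of_int (rcf_q a (Suc j)) + t * of_int (rcf_q a j))" for t :: real
  have conv: "of_rat (convergent_rcf a k) \<in> f ` I" if "Suc (Suc j) \<le> k" "enat k \<le> N" for k
  proof -
    define t where "t = cfrac (map a [Suc (Suc j)..<Suc k])"
    have pos: "\<forall>i\<in>{1..k}. a i \<ge> 1"
      using is_rcf_quotient_pos[OF assms(1) that(2)] by auto
    have eq: "map a [Suc (Suc j)..<Suc k] = b # map a [Suc (Suc (Suc j))..<Suc k]"
      using that(1) by (subst upt_conv_Cons) (auto simp: b_def)
    have "\<forall>c\<in>set (b # map a [Suc (Suc (Suc j))..<Suc k]). c \<ge> 1"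
      unfolding eq[symmetric] using pos by auto
    from cfrac_Cons_bounds[OF this] have "1 / (of_nat b + 1) \<le> t" "t \<le> 1 / of_nat b"
      unfolding t_def eq by blast+
    then have "of_rat (1 / (of_nat b + 1)) \<le> (of_rat t :: real)"
      "(of_rat t :: real) \<le> of_rat (1 / of_nat b)"
      by (simp_all only: of_rat_less_eq)
    then have "of_rat t \<in> I"
      by (simp add: I_def of_rat_divide of_rat_add)
    moreover have "of_rat (convergent_rcf a k) = f (of_rat t)"
      using convergent_rcf_tail[OF pos, of j] that(1)
      by (simp add: f_def t_def of_rat_divide of_rat_add of_rat_mult)
    ultimately show ?thesis by blast
  qed
  have "\<forall>i\<in>{1..Suc j}. a i \<ge> 1" "\<forall>i\<in>{1..Suc (Suc j)}. a i \<ge> 1"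
    using is_rcf_quotient_pos[OF assms] by auto
  then have q: "rcf_q a (Suc j) > 0" "rcf_q a j > 0"
    using rcf_q_bounds(1) by blast+
  \<comment> \<open>The pole of the fractional linear map \<open>f\<close> is negative, hence
    outside \<open>I\<close>.\<close>
  have "real_of_int (rcf_q a (Suc j)) + t * real_of_int (rcf_q a j) \<noteq> 0" if "t \<in> I" for t
  proof -
    have "t \<ge> 0" using that order_trans[of 0 "1 / (real b + 1)" t] by (simp add: I_def)
    with q show ?thesis by (intro less_imp_neq[THEN not_sym] add_pos_nonneg) simp_all
  qed
  then have "continuous_on I f"
    unfolding f_def by (intro continuous_intros) auto
  then have closed: "closed (f ` I)"
    unfolding I_def by (intro compact_imp_closed compact_continuous_image compact_Icc)
  have "x \<in> f ` I"
  proof (cases N)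
    case (enat k)
    with assms conv[of k] show ?thesis by (simp add: is_rcf_def)
  next
    case infinity
    with assms(1) have "(\<lambda>k. of_rat (convergent_rcf a k)) \<longlonglongrightarrow> x" by (simp add: is_rcf_def)
    \<comment> \<open>Only convergents that already contain the quotient \<open>b\<close> are
      covered, which suffices for the limit.\<close>
    moreover have "\<forall>\<^sub>F k in sequentially. of_rat (convergent_rcf a k) \<in> f ` I"
      using conv infinity by (intro eventually_sequentiallyI[of "Suc (Suc j)"]) simp
    ultimately show ?thesis
      by (intro Lim_in_closed_set[OF closed, where F = sequentially]) simp_all
  qed
  then show thesis using that by (auto simp: f_def I_def b_def)
qed

text \<open>Subtracting either convergent from the fractional linear form of \<open>x\<close> leaves
  only the determinant in the numerator, up to a factor \<open>- t\<close> for the later convergent.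
  The witnesses are \<open>u = 1 / t\<close> and \<open>w = q / q'\<close>.\<close>

lemma approx_coeff_formula:
  assumes "is_rcf x a N" and "enat (Suc (Suc j)) \<le> N"
  obtains u w :: real where
    "real (a (Suc j)) \<le> w" "w \<le> real (a (Suc j)) + 1"
    "real (a (Suc (Suc j))) \<le> u" "u \<le> real (a (Suc (Suc j))) + 1"
    "approx_coeff a x j = 1 / (w + 1 / u)" "approx_coeff a x (Suc j) = 1 / (u + 1 / w)"
proof -
  obtain t where t: "1 / (real (a (Suc (Suc j))) + 1) \<le> t" "t \<le> 1 / real (a (Suc (Suc j)))"
    and x: "x = (of_int (rcf_p a (Suc j)) + t * of_int (rcf_p a j)) /
      (of_int (rcf_q a (Suc j)) + t * of_int (rcf_q a j))"
    using is_rcf_tail[OF assms] .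
  define p q p' q' :: real where "p = of_int (rcf_p a (Suc j))" and "q = of_int (rcf_q a (Suc j))"
    and "p' = of_int (rcf_p a j)" and "q' = of_int (rcf_q a j)"
  have a1: "a i \<ge> 1" if "i \<ge> 1" "i \<le> Suc (Suc j)" for i
    using is_rcf_quotient_pos[OF assms that] .
  then have pos: "\<forall>i\<in>{1..Suc j}. a i \<ge> 1" "\<forall>i\<in>{1..Suc (Suc j)}. a i \<ge> 1" by auto
  have q: "q > 0" "q' > 0"
    using rcf_q_bounds(1)[OF pos(1)] rcf_q_bounds(1)[OF pos(2)] by (simp_all add: q_def q'_def)
  have "of_int (int (a (Suc j)) * rcf_q a j) \<le> q"
    "q \<le> of_int ((int (a (Suc j)) + 1) * rcf_q a j)"
    unfolding q_def of_int_le_iff using rcf_q_bounds(2,3)[OF pos(1)] by blast+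
  then have w: "real (a (Suc j)) \<le> q / q'" "q / q' \<le> real (a (Suc j)) + 1"
    using q by (simp_all add: q'_def field_simps)
  have t0: "t > 0" using t(1) by (rule less_le_trans[rotated]) simp
  have u: "real (a (Suc (Suc j))) \<le> 1 / t" "1 / t \<le> real (a (Suc (Suc j))) + 1"
    using t t0 a1[of "Suc (Suc j)"] by (simp_all add: field_simps)
  have "real_of_int \<bar>rcf_p a (Suc j) * rcf_q a j - rcf_p a j * rcf_q a (Suc j)\<bar> = 1"
    using rcf_det[OF pos(1)] by simp
  then have det: "\<bar>p * q' - p' * q\<bar> = 1"
    by (simp add: p_def q_def p'_def q'_def)
  define D where "D = q + t * q'"
  have D: "D > 0" using q t0 by (simp add: D_def add_pos_pos)
  have x: "x = (p + t * p') / D"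
    by (simp add: x p_def q_def p'_def q'_def D_def)
  have "x - p' / q' = (p * q' - p' * q) / (D * q')"
    using q D by (simp add: x field_simps) (simp add: D_def algebra_simps)
  then have "q'\<^sup>2 * \<bar>x - p' / q'\<bar> = q' / D"
    using q D det by (simp add: abs_mult power2_eq_square)
  moreover have "q' / D = 1 / (q / q' + 1 / (1 / t))"
    using q by (simp add: D_def field_simps)
  ultimately have "approx_coeff a x j = 1 / (q / q' + 1 / (1 / t))"
    by (simp add: approx_coeff_def p'_def q'_def)
  moreover
  have "x - p / q = - t * (p * q' - p' * q) / (D * q)"
    using q D by (simp add: x field_simps) (simp add: D_def algebra_simps)
  then have "q\<^sup>2 * \<bar>x - p / q\<bar> = t * q / D"
    using q D det t0 by (simp add: abs_mult power2_eq_square)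
  moreover have "t * q / D = 1 / (1 / t + 1 / (q / q'))"
    using q t0 D by (simp add: D_def field_simps)
  ultimately show thesis
    using that[OF w u] by (simp add: approx_coeff_def p_def q_def)
qed

section \<open>Monotonicity estimates on the rectangle of pairs \<open>(u, w)\<close>\<close>

lemma inverse_add_inverse_mono:
  fixes u w u' w' :: real
  assumes "0 < u" "u \<le> u'" "0 < w'" "w' \<le> w"
  shows "1 / (w + 1 / u) \<le> 1 / (w' + 1 / u')"
proof -
  have "1 / u' \<le> 1 / u" using assms by (simp add: frac_le)
  moreover have "0 < w' + 1 / u'" using assms by (simp add: add_pos_pos)
  ultimately show ?thesis using assms by (intro divide_left_mono mult_pos_pos) auto
qed

lemma inverse_add_inverse_antimono_diag:
  fixes u w :: real
  assumes "1 \<le> u" "u \<le> w"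
  shows "1 / (w + 1 / w) \<le> 1 / (u + 1 / u)"
proof -
  \<comment> \<open>The difference of \<open>w + 1 / w\<close> and \<open>u + 1 / u\<close> is
    \<open>(w - u) * (u * w - 1) / (u * w)\<close>.\<close>
  have "1 * 1 \<le> u * w" using assms by (intro mult_mono) auto
  then have "(w - u) * 1 \<le> (w - u) * (u * w)" using assms by (intro mult_left_mono) auto
  then have "u + 1 / u \<le> w + 1 / w" using assms by (simp add: field_simps)
  moreover have "0 < u + 1 / u" using assms by (simp add: add_pos_pos)
  ultimately show ?thesis by (intro divide_left_mono mult_pos_pos) auto
qed

text \<open>The corners of the square give weaker bounds than these. The order of \<open>u\<close>
  and \<open>w\<close> allows a move to the diagonal first, and then along it to the endpoint
  \<open>m\<close> or \<open>m + 1\<close>.\<close>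

lemma equal_quotient_bounds:
  fixes u w m :: real
  assumes "1 \<le> m" "m \<le> u" "u \<le> m + 1" "m \<le> w" "w \<le> m + 1"
  shows "min (1 / (w + 1 / u)) (1 / (u + 1 / w)) \<le> m / (m\<^sup>2 + 1)"
    and "(m + 1) / ((m + 1)\<^sup>2 + 1) \<le> max (1 / (w + 1 / u)) (1 / (u + 1 / w))"
proof -
  have diag: "1 / (c + 1 / c) = c / (c\<^sup>2 + 1)" if "c \<ge> 1" for c :: real
    using that by (simp add: field_simps power2_eq_square)
  have *: "1 / (z + 1 / y) \<le> m / (m\<^sup>2 + 1) \<and> (m + 1) / ((m + 1)\<^sup>2 + 1) \<le> 1 / (y + 1 / z)"
    if "m \<le> y" "y \<le> z" "z \<le> m + 1" for y z
  proof
    have "1 / (z + 1 / y) \<le> 1 / (y + 1 / y)"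
      using that assms(1) by (intro inverse_add_inverse_mono) auto
    also have "\<dots> \<le> 1 / (m + 1 / m)"
      using that assms(1) by (intro inverse_add_inverse_antimono_diag) auto
    finally show "1 / (z + 1 / y) \<le> m / (m\<^sup>2 + 1)" using diag assms(1) by simp
    have "1 / ((m + 1) + 1 / (m + 1)) \<le> 1 / (z + 1 / z)"
      using that assms(1) by (intro inverse_add_inverse_antimono_diag) auto
    also have "\<dots> \<le> 1 / (y + 1 / z)"
      using that assms(1) by (intro inverse_add_inverse_mono) auto
    finally show "(m + 1) / ((m + 1)\<^sup>2 + 1) \<le> 1 / (y + 1 / z)"
      using diag[of "m + 1"] assms(1) by simp
  qed
  show "min (1 / (w + 1 / u)) (1 / (u + 1 / w)) \<le> m / (m\<^sup>2 + 1)"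
    "(m + 1) / ((m + 1)\<^sup>2 + 1) \<le> max (1 / (w + 1 / u)) (1 / (u + 1 / w))"
    \<comment> \<open>Exchanging \<open>u\<close> and \<open>w\<close> exchanges the two
      coefficients, so the ordered estimate covers both cases.\<close>
    using *[of u w] *[of w u] assms by (cases "u \<le> w"; simp add: min_le_iff_disj le_max_iff_disj)+
qed

text \<open>Here \<open>u\<close> belongs to the smaller quotient and \<open>w\<close> to the larger
  one. The single corner \<open>u = m + 1\<close>, \<open>w = M\<close> is extremal for both
  coefficients.\<close>

lemma distinct_quotient_bounds:
  fixes u w m M :: real
  assumes "0 < m" "m \<le> u" "u \<le> m + 1" "0 < M" "M \<le> w"
  shows "1 / (w + 1 / u) \<le> (m + 1) / ((m + 1) * M + 1)"
    and "M / ((m + 1) * M + 1) \<le> 1 / (u + 1 / w)"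
proof -
  have "1 / (w + 1 / u) \<le> 1 / (M + 1 / (m + 1))"
    using assms by (intro inverse_add_inverse_mono) auto
  also have "\<dots> = (m + 1) / ((m + 1) * M + 1)"
    using assms by (simp add: divide_simps algebra_simps)
  finally show "1 / (w + 1 / u) \<le> (m + 1) / ((m + 1) * M + 1)" .
  have "M / ((m + 1) * M + 1) = 1 / ((m + 1) + 1 / M)"
    using assms by (simp add: divide_simps algebra_simps)
  also have "\<dots> \<le> 1 / (u + 1 / w)"
    using assms by (intro inverse_add_inverse_mono) auto
  finally show "M / ((m + 1) * M + 1) \<le> 1 / (u + 1 / w)" .
qed

section \<open>Equal and distinct neighbouring quotients\<close>

theorem theorem2p1:
  fixes x :: real and a :: "nat \<Rightarrow> nat" and N :: enat and n m M :: nat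
  assumes "is_rcf x a N"
    and "n \<ge> 1" and "enat (n + 1) \<le> N"
    and "m = min (a n) (a (n + 1))" and "M = max (a n) (a (n + 1))"
    and "M \<ge> 2"
  shows "m \<ge> 1 \<and>
    (m = M \<and> m \<ge> 2 \<longrightarrow>
       min (approx_coeff a x (n - 1)) (approx_coeff a x n) \<le> real m / ((real m)\<^sup>2 + 1) \<and>
       real m / ((real m)\<^sup>2 + 1) \<le> 2 / 5 \<and>
       max (approx_coeff a x (n - 1)) (approx_coeff a x n)
         \<ge> (real m + 1) / ((real m + 1)\<^sup>2 + 1)) \<and>
    (1 \<le> m \<and> m < M \<longrightarrow>
       min (approx_coeff a x (n - 1)) (approx_coeff a x n)
         \<le> (real m + 1) / ((real m + 1) * real M + 1) \<and>
       (real m + 1) / ((real m + 1) * real M + 1) \<le> 2 / 5 \<and>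
       max (approx_coeff a x (n - 1)) (approx_coeff a x n)
         \<ge> real M / ((real m + 1) * real M + 1))"
proof -
  define \<Theta> where "\<Theta> = approx_coeff a x"
  obtain j where n: "n = Suc j" using assms(2) by (cases n) auto
  have N: "enat (Suc (Suc j)) \<le> N" using assms(3) n by simp
  obtain u w where w: "real (a n) \<le> w" "w \<le> real (a n) + 1"
    and u: "real (a (n + 1)) \<le> u" "u \<le> real (a (n + 1)) + 1"
    and \<Theta>: "\<Theta> (n - 1) = 1 / (w + 1 / u)" "\<Theta> n = 1 / (u + 1 / w)"
    using approx_coeff_formula[OF assms(1) N] unfolding n \<Theta>_def by (metis Suc_eq_plus1 diff_Suc_1)
  have "a n \<ge> 1" "a (n + 1) \<ge> 1"
    using is_rcf_quotient_pos[OF assms(1,3)] assms(2) by simp_all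
  then have m: "m \<ge> 1" by (simp add: assms(4))
  have eq: "min (\<Theta> (n - 1)) (\<Theta> n) \<le> real m / ((real m)\<^sup>2 + 1) \<and>
      real m / ((real m)\<^sup>2 + 1) \<le> 2 / 5 \<and>
      max (\<Theta> (n - 1)) (\<Theta> n) \<ge> (real m + 1) / ((real m + 1)\<^sup>2 + 1)"
    if "m = M" "m \<ge> 2"
  proof -
    have a: "a n = m" "a (n + 1) = m"
      using that(1) assms(4,5) by (auto simp: min_def max_def split: if_splits)
    \<comment> \<open>The product is \<open>2 * (m^2 + 1) - 5 * m\<close>, so \<open>2 / 5\<close>
      is attained at \<open>m = 2\<close>.\<close>
    have "0 \<le> (real m - 2) * (2 * real m - 1)" using that(2) by (intro mult_nonneg_nonneg) auto
    moreover have "0 < (real m)\<^sup>2 + 1" by (simp add: add_nonneg_pos)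
    ultimately have "real m / ((real m)\<^sup>2 + 1) \<le> 2 / 5"
      by (simp add: divide_le_eq algebra_simps power2_eq_square)
    then show ?thesis
      unfolding \<Theta> using equal_quotient_bounds[of "real m" u w] m u w a by simp
  qed
  have neq: "min (\<Theta> (n - 1)) (\<Theta> n) \<le> (real m + 1) / ((real m + 1) * real M + 1) \<and>
      (real m + 1) / ((real m + 1) * real M + 1) \<le> 2 / 5 \<and>
      max (\<Theta> (n - 1)) (\<Theta> n) \<ge> real M / ((real m + 1) * real M + 1)"
    if "m < M"
  proof -
    have "5 * (real m + 1) \<le> 2 * ((real m + 1) * real M + 1)"
    \<comment> \<open>\<open>M = 2\<close> forces \<open>m = 1\<close>, where both sides equal 10;
      for \<open>M\<close> at least 3 the factor \<open>2 * M\<close> already exceeds 5.\<close>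
    proof (cases "M = 2")
      case True
      then show ?thesis using that m by simp
    next
      case False
      then have "(real m + 1) * 3 \<le> (real m + 1) * real M"
        using assms(6) by (intro mult_left_mono) auto
      then show ?thesis by (simp add: algebra_simps)
    qed
    moreover have "0 < (real m + 1) * real M + 1" by (simp add: add_nonneg_pos)
    ultimately have *: "(real m + 1) / ((real m + 1) * real M + 1) \<le> 2 / 5"
      by (simp only: divide_le_eq) simp
    \<comment> \<open>In the first case \<open>w\<close> is the variable near the larger quotient;
      in the second \<open>u\<close> is, and the two coefficients trade places.\<close>
    consider "a n = M" "a (n + 1) = m" | "a n = m" "a (n + 1) = M"
      using assms(4,5) by (auto simp: min_def max_def split: if_splits)
    then show ?thesis
    proof cases
      case 1
      then show ?thesis
        unfolding \<Theta> using distinct_quotient_bounds[of "real m" u "real M" w] m that u w *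
        by (simp add: min_le_iff_disj le_max_iff_disj)
    next
      case 2
      then show ?thesis
        unfolding \<Theta> using distinct_quotient_bounds[of "real m" w "real M" u] m that u w *
        by (simp add: min_le_iff_disj le_max_iff_disj)
    qed
  qed
  show ?thesis using m eq neq unfolding \<Theta>_def by blast
qed

end
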